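(* Let $X$ be a locally compact, non-compact Hausdorff space and let $A$ be a natural regular Banach function algebra on $X$ whose norm is the uniform norm $\|\cdot\|_X$, and which has a bounded approximate identity contained in $A_c$. Let $n$ be a positive integer and let $\tau\in A_{\mathrm{loc}}$. Suppose that $(A,\|\cdot\|_X)$ is a BSE-algebra. Then the following statements are equivalent: (i) $A_{\tau(n)}$ is a BSE-algebra. (ii) $\tau$ is bounded.
   Context: A Banach function algebra on $X$ is a subalgebra $A$ of $C_0(X)$ that separates strongly the points of $X$ (for $x\ne y$ in $X$ there is $f\in A$ with $f(x)\neq f(y)$, and for each $x\in X$ there is $f\in A$ with $f(x)\ne 0$) and is a Banach algebra under a norm $\|\cdot\|$. It is natural if $x\mapsto\phi_x$, $\phi_x(f)=f(x)$, is a homeomorphism of $X$ onto the character space $\Delta(A)$; so $\Delta(A)=X$. $A_c$ is the set of $f\in A$ with compact support. The uniform norm is $\|f\|_X=\sup_{x\in X}|f(x)|$. A continuous function $\sigma:X\to\mathbb{C}$ is a local $A$-function if $f\sigma\in A$ for all $f\in A_c$; $A_{\mathrm{loc}}$ is the set of local $A$-functions. For a positive integer $n$ and continuous $\tau:X\to\mathbb{C}$, $A_{\tau(n)}=\{f\in A: f\tau^k\in A\ (0\le k\le n)\}$ with norm $\|f\|_{\tau(n)}=\sum_{k=0}^n\|f\tau^k\|$ and pointwise product. BSE-algebras. A commutative Banach algebra $A$ is without order if $a\in A$ and $aA=\{0\}$ imply $a=0$. A multiplier of $A$ is a linear operator $T:A\to A$ with $aT(b)=T(a)b$ for all $a,b\in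 A$; $\mathcal{M}(A)$ is the space of all multipliers. $\Delta(A)$ is the space of characters (non-zero homomorphisms $A\to\mathbb{C}$) with the Gel'fand topology, and $\widehat{a}(\phi)=\phi(a)$. For each $T\in\mathcal{M}(A)$ there is a unique bounded continuous function $\widehat{T}$ on $\Delta(A)$ with $\widehat{T(a)}(\phi)=\widehat{T}(\phi)\widehat{a}(\phi)$ for all $a\in A$, $\phi\in\Delta(A)$; put $\widehat{\mathcal{M}(A)}=\{\widehat{T}:T\in\mathcal{M}(A)\}$. A bounded continuous function $\sigma$ on $\Delta(A)$ is a BSE-function if there is a constant $C>0$ such that for all $\phi_1,\dots,\phi_n\in\Delta(A)$ and $c_1,\dots,c_n\in\mathbb{C}$, $\left|\sum_{i=1}^n c_i\sigma(\phi_i)\right|\le C\left\|\sum_{i=1}^n c_i\phi_i\right\|_{A^*}$; $C_{\mathrm{BSE}}(\Delta(A))$ is the set of all BSE-functions. A without order commutative Banach algebra $A$ is a BSE-algebra if $C_{\mathrm{BSE}}(\Delta(A))=\widehat{\mathcal{M}(A)}$. *)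

theory Defs
  imports "HOL-Analysis.Analysis"
begin

section \<open>Commutative Banach algebras\<close>

text \<open>Algebras need not have an identity, so the ring records of HOL-Algebra (which carry
  a unit) are not used.\<close>

record 'b calgebra =
  bcarrier :: "'b set"
  badd :: "'b \<Rightarrow> 'b \<Rightarrow> 'b"
  bzero :: "'b"
  bscale :: "complex \<Rightarrow> 'b \<Rightarrow> 'b"
  bmult :: "'b \<Rightarrow> 'b \<Rightarrow> 'b"
  bnorm :: "'b \<Rightarrow> real"

definition bdiff :: "('b, 'm) calgebra_scheme \<Rightarrow> 'b \<Rightarrow> 'b \<Rightarrow> 'b" where
  "bdiff B a b = badd B a (bscale B (-1) b)"

locale comm_banach_algebra =
  fixes B :: "('b, 'm) calgebra_scheme"
  assumes zero_closed: "bzero B \<in> bcarrier B"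
    and add_closed: "\<lbrakk>a \<in> bcarrier B; b \<in> bcarrier B\<rbrakk> \<Longrightarrow> badd B a b \<in> bcarrier B"
    and scale_closed: "a \<in> bcarrier B \<Longrightarrow> bscale B c a \<in> bcarrier B"
    and mult_closed: "\<lbrakk>a \<in> bcarrier B; b \<in> bcarrier B\<rbrakk> \<Longrightarrow> bmult B a b \<in> bcarrier B"
    and add_assoc: "\<lbrakk>a \<in> bcarrier B; b \<in> bcarrier B; d \<in> bcarrier B\<rbrakk>
          \<Longrightarrow> badd B (badd B a b) d = badd B a (badd B b d)"
    and add_commute: "\<lbrakk>a \<in> bcarrier B; b \<in> bcarrier B\<rbrakk> \<Longrightarrow> badd B a b = badd B b a"
    and add_zero: "a \<in> bcarrier B \<Longrightarrow> badd B (bzero B) a = a"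
    and add_inverse: "a \<in> bcarrier B \<Longrightarrow> badd B a (bscale B (-1) a) = bzero B"
    and scale_one: "a \<in> bcarrier B \<Longrightarrow> bscale B 1 a = a"
    and scale_scale: "a \<in> bcarrier B \<Longrightarrow> bscale B c (bscale B r a) = bscale B (c * r) a"
    and scale_add_right: "\<lbrakk>a \<in> bcarrier B; b \<in> bcarrier B\<rbrakk>
          \<Longrightarrow> bscale B c (badd B a b) = badd B (bscale B c a) (bscale B c b)"
    and scale_add_left: "a \<in> bcarrier B
          \<Longrightarrow> bscale B (c + r) a = badd B (bscale B c a) (bscale B r a)"
    and mult_assoc: "\<lbrakk>a \<in> bcarrier B; b \<in> bcarrier B; d \<in> bcarrier B\<rbrakk>
          \<Longrightarrow> bmult B (bmult B a b) d = bmult B a (bmult B b d)"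
    and mult_commute: "\<lbrakk>a \<in> bcarrier B; b \<in> bcarrier B\<rbrakk> \<Longrightarrow> bmult B a b = bmult B b a"
    and mult_add: "\<lbrakk>a \<in> bcarrier B; b \<in> bcarrier B; d \<in> bcarrier B\<rbrakk>
          \<Longrightarrow> bmult B a (badd B b d) = badd B (bmult B a b) (bmult B a d)"
    and mult_scale: "\<lbrakk>a \<in> bcarrier B; b \<in> bcarrier B\<rbrakk>
          \<Longrightarrow> bmult B a (bscale B c b) = bscale B c (bmult B a b)"
    and norm_nonneg: "a \<in> bcarrier B \<Longrightarrow> 0 \<le> bnorm B a"
    and norm_eq_zero: "a \<in> bcarrier B \<Longrightarrow> bnorm B a = 0 \<longleftrightarrow> a = bzero B"
    and norm_triangle: "\<lbrakk>a \<in> bcarrier B; b \<in> bcarrier B\<rbrakk>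
          \<Longrightarrow> bnorm B (badd B a b) \<le> bnorm B a + bnorm B b"
    and norm_scale: "a \<in> bcarrier B \<Longrightarrow> bnorm B (bscale B c a) = cmod c * bnorm B a"
    and norm_mult: "\<lbrakk>a \<in> bcarrier B; b \<in> bcarrier B\<rbrakk>
          \<Longrightarrow> bnorm B (bmult B a b) \<le> bnorm B a * bnorm B b"
    and complete: "\<lbrakk>\<And>m. s m \<in> bcarrier B;
            \<And>e. e > 0 \<Longrightarrow> \<exists>M. \<forall>m\<ge>M. \<forall>k\<ge>M. bnorm B (bdiff B (s m) (s k)) < e\<rbrakk>
          \<Longrightarrow> \<exists>a\<in>bcarrier B. (\<lambda>m. bnorm B (bdiff B (s m) a)) \<longlonglongrightarrow> 0"

definition without_order :: "('b, 'm) calgebra_scheme \<Rightarrow> bool" where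
  "without_order B \<longleftrightarrow>
     (\<forall>a\<in>bcarrier B. (\<forall>b\<in>bcarrier B. bmult B a b = bzero B) \<longrightarrow> a = bzero B)"

text \<open>Maps defined on the carrier are represented by extensional functions, so that the sets
  of characters, multipliers and functions on the character space below contain exactly one
  HOL function for each mathematical object.\<close>

definition multipliers :: "('b, 'm) calgebra_scheme \<Rightarrow> ('b \<Rightarrow> 'b) set" where
  "multipliers B = {T \<in> bcarrier B \<rightarrow>\<^sub>E bcarrier B.
     (\<forall>a\<in>bcarrier B. \<forall>b\<in>bcarrier B. T (badd B a b) = badd B (T a) (T b)) \<and>
     (\<forall>c. \<forall>a\<in>bcarrier B. T (bscale B c a) = bscale B c (T a)) \<and>
     (\<forall>a\<in>bcarrier B. \<forall>b\<in>bcarrier B. bmult B a (T b) = bmult B (T a) b)}"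

definition characters :: "('b, 'm) calgebra_scheme \<Rightarrow> ('b \<Rightarrow> complex) set" where
  "characters B = {\<phi> \<in> extensional (bcarrier B).
     (\<forall>a\<in>bcarrier B. \<forall>b\<in>bcarrier B. \<phi> (badd B a b) = \<phi> a + \<phi> b) \<and>
     (\<forall>c. \<forall>a\<in>bcarrier B. \<phi> (bscale B c a) = c * \<phi> a) \<and>
     (\<forall>a\<in>bcarrier B. \<forall>b\<in>bcarrier B. \<phi> (bmult B a b) = \<phi> a * \<phi> b) \<and>
     (\<exists>a\<in>bcarrier B. \<phi> a \<noteq> 0)}"

text \<open>The Gel'fand topology is the relative topology of pointwise convergence on the algebra.\<close>

definition gelfand_topology :: "('b, 'm) calgebra_scheme \<Rightarrow> ('b \<Rightarrow> complex) topology" where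
  "gelfand_topology B =
     subtopology (product_topology (\<lambda>_. euclidean) (bcarrier B)) (characters B)"

definition bcont_functions :: "('b, 'm) calgebra_scheme \<Rightarrow> (('b \<Rightarrow> complex) \<Rightarrow> complex) set" where
  "bcont_functions B = {\<sigma> \<in> extensional (characters B).
     continuous_map (gelfand_topology B) euclidean \<sigma> \<and> bounded (\<sigma> ` characters B)}"

text \<open>The functions \<open>\<sigma> = T^\<close>: for each multiplier \<open>T\<close> there is exactly one bounded
  continuous \<open>\<sigma>\<close> with the stated property, because every character is non-zero somewhere.\<close>

definition multiplier_transforms ::
    "('b, 'm) calgebra_scheme \<Rightarrow> (('b \<Rightarrow> complex) \<Rightarrow> complex) set" where
  "multiplier_transforms B = {\<sigma> \<in> bcont_functions B. \<exists>T\<in>multipliers B.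
     \<forall>a\<in>bcarrier B. \<forall>\<phi>\<in>characters B. \<phi> (T a) = \<sigma> \<phi> * \<phi> a}"

definition dual_norm :: "('b, 'm) calgebra_scheme \<Rightarrow> ('b \<Rightarrow> complex) \<Rightarrow> real" where
  "dual_norm B \<psi> = (SUP a\<in>{a \<in> bcarrier B. bnorm B a \<le> 1}. cmod (\<psi> a))"

definition BSE_functions ::
    "('b, 'm) calgebra_scheme \<Rightarrow> (('b \<Rightarrow> complex) \<Rightarrow> complex) set" where
  "BSE_functions B = {\<sigma> \<in> bcont_functions B. \<exists>C>0.
     \<forall>(m::nat) (\<phi> :: nat \<Rightarrow> 'b \<Rightarrow> complex) (c :: nat \<Rightarrow> complex).
       (\<forall>i<m. \<phi> i \<in> characters B) \<longrightarrow>
       cmod (\<Sum>i<m. c i * \<sigma> (\<phi> i)) \<le> C * dual_norm B (\<lambda>a. \<Sum>i<m. c i * \<phi> i a)}"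

definition BSE_algebra :: "('b, 'm) calgebra_scheme \<Rightarrow> bool" where
  "BSE_algebra B \<longleftrightarrow> comm_banach_algebra B \<and> without_order B \<and>
     BSE_functions B = multiplier_transforms B"

text \<open>A net is represented by the filter on the algebra generated by the images of its tails;
  conversely every proper filter arises in this way from a net.\<close>

definition has_bounded_approximate_identity_in ::
    "('b, 'm) calgebra_scheme \<Rightarrow> 'b set \<Rightarrow> bool" where
  "has_bounded_approximate_identity_in B S \<longleftrightarrow>
     (\<exists>(F :: 'b filter) M. F \<noteq> bot \<and>
        eventually (\<lambda>e. e \<in> bcarrier B \<and> e \<in> S \<and> bnorm B e \<le> M) F \<and>
        (\<forall>a\<in>bcarrier B. ((\<lambda>e. bnorm B (bdiff B (bmult B a e) a)) \<longlongrightarrow> 0) F))"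

section \<open>Banach function algebras\<close>

definition C0 :: "('a::topological_space \<Rightarrow> complex) set" where
  "C0 = {f. continuous_on UNIV f \<and> (\<forall>e>0. compact {x. e \<le> cmod (f x)})}"

definition uniform_norm :: "('a \<Rightarrow> complex) \<Rightarrow> real" where
  "uniform_norm f = (SUP x. cmod (f x))"

definition function_algebra ::
    "('a \<Rightarrow> complex) set \<Rightarrow> (('a \<Rightarrow> complex) \<Rightarrow> real) \<Rightarrow> ('a \<Rightarrow> complex) calgebra" where
  "function_algebra A N = \<lparr>bcarrier = A, badd = (\<lambda>f g x. f x + g x), bzero = (\<lambda>x. 0),
     bscale = (\<lambda>c f x. c * f x), bmult = (\<lambda>f g x. f x * g x), bnorm = N\<rparr>"

definition strongly_separates_points :: "('a \<Rightarrow> complex) set \<Rightarrow> bool" where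
  "strongly_separates_points A \<longleftrightarrow>
     (\<forall>x y. x \<noteq> y \<longrightarrow> (\<exists>f\<in>A. f x \<noteq> f y)) \<and> (\<forall>x. \<exists>f\<in>A. f x \<noteq> 0)"

text \<open>Being a subalgebra is part of \<^const>\<open>comm_banach_algebra\<close>, as the operations of
  \<^const>\<open>function_algebra\<close> are pointwise.\<close>

definition banach_function_algebra ::
    "('a::topological_space \<Rightarrow> complex) set \<Rightarrow> (('a \<Rightarrow> complex) \<Rightarrow> real) \<Rightarrow> bool" where
  "banach_function_algebra A N \<longleftrightarrow>
     A \<subseteq> C0 \<and> strongly_separates_points A \<and> comm_banach_algebra (function_algebra A N)"

definition natural ::
    "('a::topological_space \<Rightarrow> complex) set \<Rightarrow> (('a \<Rightarrow> complex) \<Rightarrow> real) \<Rightarrow> bool" where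
  "natural A N \<longleftrightarrow> homeomorphic_map euclidean (gelfand_topology (function_algebra A N))
     (\<lambda>x. restrict (\<lambda>f. f x) A)"

text \<open>For a natural algebra, whose character space is identified with \<open>X\<close>, this is regularity
  in the sense of the Gel'fand representation.\<close>

definition regular :: "('a::topological_space \<Rightarrow> complex) set \<Rightarrow> bool" where
  "regular A \<longleftrightarrow>
     (\<forall>E x. closed E \<and> x \<notin> E \<longrightarrow> (\<exists>f\<in>A. f x \<noteq> 0 \<and> (\<forall>y\<in>E. f y = 0)))"

definition compact_part :: "('a::topological_space \<Rightarrow> complex) set \<Rightarrow> ('a \<Rightarrow> complex) set" where
  "compact_part A = {f \<in> A. compact (closure {x. f x \<noteq> 0})}"

definition local_functions ::
    "('a::topological_space \<Rightarrow> complex) set \<Rightarrow> ('a \<Rightarrow> complex) set" where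
  "local_functions A =
     {\<sigma>. continuous_on UNIV \<sigma> \<and> (\<forall>f\<in>compact_part A. (\<lambda>x. f x * \<sigma> x) \<in> A)}"

definition tau_algebra ::
    "('a \<Rightarrow> complex) set \<Rightarrow> ('a \<Rightarrow> complex) \<Rightarrow> nat \<Rightarrow> ('a \<Rightarrow> complex) set" where
  "tau_algebra A \<tau> n = {f \<in> A. \<forall>k\<le>n. (\<lambda>x. f x * \<tau> x ^ k) \<in> A}"

definition tau_norm ::
    "(('a \<Rightarrow> complex) \<Rightarrow> real) \<Rightarrow> ('a \<Rightarrow> complex) \<Rightarrow> nat \<Rightarrow> ('a \<Rightarrow> complex) \<Rightarrow> real" where
  "tau_norm N \<tau> n f = (\<Sum>k\<le>n. N (\<lambda>x. f x * \<tau> x ^ k))"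

end

theory Submission
  imports Defs
begin

text \<open>If \<open>A\<^sub>\<tau>\<^sub>(\<^sub>n\<^sub>)\<close> is a BSE-algebra, then the constant function \<open>1\<close>, being the transform of the
  identity multiplier, is a BSE-function. A single evaluation \<open>\<phi>\<^sub>x\<close> in the BSE-inequality gives
  \<open>1 \<le> C \<parallel>\<phi>\<^sub>x\<parallel>\<close>, whereas \<open>\<bar>f x\<bar> \<bar>\<tau> x\<bar>\<^sup>n \<le> \<parallel>f\<parallel>\<^sub>\<tau>\<^sub>(\<^sub>n\<^sub>)\<close> gives \<open>\<parallel>\<phi>\<^sub>x\<parallel> \<bar>\<tau> x\<bar>\<^sup>n \<le> 1\<close>; hence
  \<open>\<bar>\<tau> x\<bar>\<^sup>n \<le> C\<close>. Conversely, if \<open>\<tau>\<close> is bounded, then multiplication by \<open>\<tau>\<close> preserves \<open>A\<close>, since it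
  maps the uniformly dense subspace \<open>A\<^sub>c\<close> into \<open>A\<close>; so \<open>A\<^sub>\<tau>\<^sub>(\<^sub>n\<^sub>) = A\<close> with an equivalent norm, and the
  BSE-property is invariant under equivalent norms.\<close>

section \<open>Equivalent norms\<close>

text \<open>Only the norm axioms and completeness depend on the norm: \<open>lower\<close> carries
  Cauchy sequences over to the old norm, \<open>upper\<close> carries their limits back.
  Submultiplicativity is assumed because equivalence of norms does not give it.\<close>

lemma comm_banach_algebra_equivalent_norm:
  assumes B: "comm_banach_algebra B"
    and scale: "\<And>c a. a \<in> bcarrier B \<Longrightarrow> N (bscale B c a) = cmod c * N a"
    and triangle: "\<And>a b. \<lbrakk>a \<in> bcarrier B; b \<in> bcarrier B\<rbrakk> \<Longrightarrow> N (badd B a b) \<le> N a + N b"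
    and mult: "\<And>a b. \<lbrakk>a \<in> bcarrier B; b \<in> bcarrier B\<rbrakk> \<Longrightarrow> N (bmult B a b) \<le> N a * N b"
    and lower: "\<And>a. a \<in> bcarrier B \<Longrightarrow> bnorm B a \<le> K * N a" and "K > 0"
    and upper: "\<And>a. a \<in> bcarrier B \<Longrightarrow> N a \<le> L * bnorm B a"
  shows "comm_banach_algebra (B\<lparr>bnorm := N\<rparr>)"
proof -
  interpret comm_banach_algebra B by (fact B)
  have nonneg: "0 \<le> N a" if "a \<in> bcarrier B" for a
    using norm_nonneg[OF that] lower[OF that] \<open>K > 0\<close>
    by (meson order_trans zero_le_mult_iff not_less)
  have zero_iff: "N a = 0 \<longleftrightarrow> a = bzero B" if "a \<in> bcarrier B" for a
  proof
    assume "N a = 0"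
    then show "a = bzero B"
      using lower[OF that] norm_nonneg[OF that] norm_eq_zero[OF that] by simp
  next
    assume "a = bzero B"
    then show "N a = 0"
      using upper[OF that] nonneg[OF that] norm_eq_zero[OF that] by simp
  qed
  have bdiff_N: "bdiff (B\<lparr>bnorm := N\<rparr>) = bdiff B"
    by (simp add: bdiff_def fun_eq_iff)
  have bdiff_closed: "bdiff B a b \<in> bcarrier B" if "a \<in> bcarrier B" "b \<in> bcarrier B" for a b
    using that by (simp add: bdiff_def add_closed scale_closed)
  have compl: "\<exists>a\<in>bcarrier B. (\<lambda>m. N (bdiff B (s m) a)) \<longlonglongrightarrow> 0"
    if s: "\<And>m. s m \<in> bcarrier B"
      and cauchy: "\<And>e. e > 0 \<Longrightarrow> \<exists>M. \<forall>m\<ge>M. \<forall>k\<ge>M. N (bdiff B (s m) (s k)) < e" for s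
  proof -
    have "\<exists>M. \<forall>m\<ge>M. \<forall>k\<ge>M. bnorm B (bdiff B (s m) (s k)) < e" if "e > 0" for e
    proof -
      obtain M where M: "\<And>m k. m \<ge> M \<Longrightarrow> k \<ge> M \<Longrightarrow> N (bdiff B (s m) (s k)) < e / K"
        using cauchy[of "e / K"] \<open>e > 0\<close> \<open>K > 0\<close> by (meson divide_pos_pos)
      have "bnorm B (bdiff B (s m) (s k)) < e" if "m \<ge> M" "k \<ge> M" for m k
        using lower[OF bdiff_closed[OF s s], of m k] M[OF that] \<open>K > 0\<close>
        by (simp add: field_simps)
      then show ?thesis by blast
    qed
    then obtain a where a: "a \<in> bcarrier B" and lim: "(\<lambda>m. bnorm B (bdiff B (s m) a)) \<longlonglongrightarrow> 0"
      using complete[of s] s by blast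
    have "(\<lambda>m. N (bdiff B (s m) a)) \<longlonglongrightarrow> 0"
    proof (rule tendsto_sandwich[OF _ _ tendsto_const])
      show "(\<lambda>m. L * bnorm B (bdiff B (s m) a)) \<longlonglongrightarrow> 0"
        using tendsto_mult_left[OF lim, of L] by simp
    qed (auto intro!: always_eventually nonneg upper bdiff_closed s a)
    with a show ?thesis by blast
  qed
  show ?thesis
    by unfold_locales
      (simp_all add: zero_closed add_closed scale_closed mult_closed add_assoc add_zero
        add_inverse scale_one scale_scale scale_add_right scale_add_left mult_assoc mult_add
        mult_scale nonneg zero_iff triangle scale mult bdiff_N compl,
       simp_all add: add_commute mult_commute)
qed

text \<open>\<open>dual_norm\<close> is a real supremum, so it bounds individual values only where
  the set is bounded above. On the unit ball each character is at most \<open>K\<close> in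
  modulus.\<close>

lemma character_combination_bounded:
  assumes bound: "\<And>\<psi> a. \<lbrakk>\<psi> \<in> characters B; a \<in> bcarrier B\<rbrakk> \<Longrightarrow> cmod (\<psi> a) \<le> K * bnorm B a"
    and "K \<ge> 0" and ch: "\<And>i. i < m \<Longrightarrow> \<phi> i \<in> characters B"
  shows "bdd_above ((\<lambda>a. cmod (\<Sum>i<m. c i * \<phi> i a)) ` {a \<in> bcarrier B. bnorm B a \<le> 1})"
proof (rule bdd_aboveI2)
  fix a assume a: "a \<in> {a \<in> bcarrier B. bnorm B a \<le> 1}"
  have "cmod (\<phi> i a) \<le> K" if "i < m" for i
    using bound[OF ch[OF that], of a] a \<open>K \<ge> 0\<close> mult_left_mono[of "bnorm B a" 1 K] by auto
  then show "cmod (\<Sum>i<m. c i * \<phi> i a) \<le> (\<Sum>i<m. cmod (c i) * K)"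
    by (intro sum_norm_le) (auto simp: norm_mult intro!: mult_left_mono)
qed

text \<open>These notions are algebraic or rest on pointwise convergence; the norm enters the
  BSE-property only through the Banach algebra axioms and \<open>dual_norm\<close>.\<close>

lemma norm_update_simps [simp]:
  "characters (B\<lparr>bnorm := N\<rparr>) = characters B"
  "multipliers (B\<lparr>bnorm := N\<rparr>) = multipliers B"
  "bcont_functions (B\<lparr>bnorm := N\<rparr>) = bcont_functions B"
  "multiplier_transforms (B\<lparr>bnorm := N\<rparr>) = multiplier_transforms B"
  "without_order (B\<lparr>bnorm := N\<rparr>) = without_order B"
proof -
  show ch: "characters (B\<lparr>bnorm := N\<rparr>) = characters B"
    by (simp add: characters_def)
  show mu: "multipliers (B\<lparr>bnorm := N\<rparr>) = multipliers B"
    by (simp add: multipliers_def)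
  show bc: "bcont_functions (B\<lparr>bnorm := N\<rparr>) = bcont_functions B"
    by (simp add: bcont_functions_def gelfand_topology_def ch)
  show "multiplier_transforms (B\<lparr>bnorm := N\<rparr>) = multiplier_transforms B"
    by (simp add: multiplier_transforms_def ch mu bc)
  show "without_order (B\<lparr>bnorm := N\<rparr>) = without_order B"
    by (simp add: without_order_def)
qed

text \<open>Scaling by \<open>1 / L\<close> maps the old unit ball into the new one, so dual norms
  grow by a factor of at most \<open>L\<close> and a BSE-constant \<open>C\<close> turns into
  \<open>C * L\<close>. The bound with \<open>K\<close> keeps the new dual norm finite.\<close>

lemma BSE_functions_norm_mono:
  assumes B: "comm_banach_algebra B" "comm_banach_algebra (B\<lparr>bnorm := N\<rparr>)"
    and \<phi>: "\<And>\<phi> a. \<lbrakk>\<phi> \<in> characters B; a \<in> bcarrier B\<rbrakk> \<Longrightarrow> cmod (\<phi> a) \<le> K * N a" and "K \<ge> 0"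
    and upper: "\<And>a. a \<in> bcarrier B \<Longrightarrow> N a \<le> L * bnorm B a" and "L > 0"
  shows "BSE_functions B \<subseteq> BSE_functions (B\<lparr>bnorm := N\<rparr>)"
proof
  let ?B = "B\<lparr>bnorm := N\<rparr>"
  interpret comm_banach_algebra B by (fact B)
  interpret N: comm_banach_algebra ?B by (fact B)
  have dual: "dual_norm B (\<lambda>a. \<Sum>i<m. c i * \<phi> i a) \<le> L * dual_norm ?B (\<lambda>a. \<Sum>i<m. c i * \<phi> i a)"
    if ch: "\<forall>i<m. \<phi> i \<in> characters B" for m :: nat and c :: "nat \<Rightarrow> complex" and \<phi>
  proof -
    let ?\<psi> = "\<lambda>a. \<Sum>i<m. c i * \<phi> i a"
    have bdd: "bdd_above ((\<lambda>a. cmod (?\<psi> a)) ` {a \<in> bcarrier ?B. bnorm ?B a \<le> 1})"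
      by (rule character_combination_bounded[where K = K]) (use assms ch in auto)
    show ?thesis
      unfolding dual_norm_def[of B]
    proof (rule cSUP_least)
      show "{a \<in> bcarrier B. bnorm B a \<le> 1} \<noteq> {}"
        using zero_closed norm_eq_zero[OF zero_closed] by force
    next
      fix a assume a: "a \<in> {a \<in> bcarrier B. bnorm B a \<le> 1}"
      define b where "b = bscale B (of_real (1 / L)) a"
      have "N b = N a / L"
        using N.norm_scale[of a "of_real (1 / L)"] a \<open>L > 0\<close> by (simp add: b_def norm_divide)
      moreover have "N a \<le> L"
        using a \<open>L > 0\<close> by (auto intro: order_trans[OF upper] mult_left_le)
      ultimately have "b \<in> {a \<in> bcarrier ?B. bnorm ?B a \<le> 1}"
        using a \<open>L > 0\<close> by (auto simp: b_def scale_closed)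
      then have "cmod (?\<psi> b) \<le> dual_norm ?B ?\<psi>"
        unfolding dual_norm_def by (rule cSUP_upper[OF _ bdd])
      moreover have "?\<psi> b = of_real (1 / L) * ?\<psi> a"
        unfolding sum_distrib_left
        by (rule sum.cong) (use ch a in \<open>auto simp: b_def characters_def\<close>)
      ultimately have "cmod (?\<psi> a) / L \<le> dual_norm ?B ?\<psi>"
        using \<open>L > 0\<close> by (simp add: norm_divide)
      then show "cmod (?\<psi> a) \<le> L * dual_norm ?B ?\<psi>"
        using \<open>L > 0\<close> by (simp add: field_simps)
    qed
  qed
  fix \<sigma> assume "\<sigma> \<in> BSE_functions B"
  then obtain C where \<sigma>: "\<sigma> \<in> bcont_functions B" and "C > 0"
    and C: "\<And>(m::nat) \<phi> c. (\<forall>i<m. \<phi> i \<in> characters B) \<Longrightarrow>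
        cmod (\<Sum>i<m. c i * \<sigma> (\<phi> i)) \<le> C * dual_norm B (\<lambda>a. \<Sum>i<m. c i * \<phi> i a)"
    unfolding BSE_functions_def by blast
  have "cmod (\<Sum>i<m. c i * \<sigma> (\<phi> i)) \<le> (C * L) * dual_norm ?B (\<lambda>a. \<Sum>i<m. c i * \<phi> i a)"
    if "\<forall>i<m. \<phi> i \<in> characters B" for m :: nat and c :: "nat \<Rightarrow> complex" and \<phi>
    using order_trans[OF C[OF that] mult_left_mono[OF dual[OF that]]] \<open>C > 0\<close>
    by (simp add: mult.assoc)
  moreover have "C * L > 0"
    using \<open>C > 0\<close> \<open>L > 0\<close> by simp
  ultimately show "\<sigma> \<in> BSE_functions ?B"
    using \<sigma> unfolding BSE_functions_def by auto
qed

text \<open>The multiplier transforms are the same for both norms, so it suffices to compare the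
  BSE-functions, once in each direction.\<close>

lemma BSE_algebra_equivalent_norm:
  assumes B: "BSE_algebra B" "comm_banach_algebra (B\<lparr>bnorm := N\<rparr>)"
    and \<phi>: "\<And>\<phi> a. \<lbrakk>\<phi> \<in> characters B; a \<in> bcarrier B\<rbrakk> \<Longrightarrow> cmod (\<phi> a) \<le> bnorm B a"
    and lower: "\<And>a. a \<in> bcarrier B \<Longrightarrow> bnorm B a \<le> K * N a" and "K > 0"
    and upper: "\<And>a. a \<in> bcarrier B \<Longrightarrow> N a \<le> L * bnorm B a" and "L > 0"
  shows "BSE_algebra (B\<lparr>bnorm := N\<rparr>)"
proof -
  let ?B = "B\<lparr>bnorm := N\<rparr>"
  have B': "comm_banach_algebra B"
    using B by (simp add: BSE_algebra_def)
  have \<phi>N: "cmod (\<phi> a) \<le> K * N a" if "\<phi> \<in> characters B" "a \<in> bcarrier B" for \<phi> a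
    using \<phi>[OF that] lower[OF that(2)] by linarith
  have "BSE_functions B \<subseteq> BSE_functions ?B"
    by (rule BSE_functions_norm_mono[where K = K and L = L])
      (use B' B \<phi>N upper \<open>K > 0\<close> \<open>L > 0\<close> in auto)
  \<comment> \<open>Restoring the old norm in \<open>?B\<close> gives \<open>B\<close> back, so the
    roles of the norms are exchanged and \<open>lower\<close> now acts as the upper
    estimate.\<close>
  moreover have "BSE_functions ?B \<subseteq> BSE_functions (?B\<lparr>bnorm := bnorm B\<rparr>)"
    by (rule BSE_functions_norm_mono[where K = 1 and L = K])
      (use B' B \<phi> lower \<open>K > 0\<close> in auto)
  ultimately have "BSE_functions ?B = BSE_functions B"
    by simp
  with B show ?thesis
    by (simp add: BSE_algebra_def)
qed

text \<open>Dual norms of characters are bounded away from zero: the BSE-inequality for the constant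
  \<open>1\<close>, with one character and coefficient \<open>1\<close>, says exactly this.\<close>

lemma BSE_algebra_single_character:
  assumes "BSE_algebra B"
  obtains C where "C > 0" "\<And>\<phi>. \<phi> \<in> characters B \<Longrightarrow> 1 \<le> C * dual_norm B \<phi>"
proof -
  interpret comm_banach_algebra B
    using assms by (simp add: BSE_algebra_def)
  define \<sigma> :: "('a \<Rightarrow> complex) \<Rightarrow> complex" where "\<sigma> = restrict (\<lambda>_. 1) (characters B)"
  have "continuous_map (gelfand_topology B) euclidean (\<lambda>_. 1 :: complex)"
    by simp
  then have "continuous_map (gelfand_topology B) euclidean \<sigma>"
    by (rule continuous_map_eq) (simp add: \<sigma>_def gelfand_topology_def)
  then have "\<sigma> \<in> bcont_functions B"
    by (auto simp: bcont_functions_def \<sigma>_def image_constant_conv)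
  moreover have "restrict id (bcarrier B) \<in> multipliers B"
    by (auto simp: multipliers_def add_closed scale_closed)
  ultimately have "\<sigma> \<in> multiplier_transforms B"
    unfolding multiplier_transforms_def
    by (intro CollectI conjI bexI) (simp_all add: \<sigma>_def)
  then have "\<sigma> \<in> BSE_functions B"
    using assms by (simp add: BSE_algebra_def)
  then obtain C where "C > 0"
    and C: "\<And>(m::nat) \<phi> c. (\<forall>i<m. \<phi> i \<in> characters B) \<Longrightarrow>
        cmod (\<Sum>i<m. c i * \<sigma> (\<phi> i)) \<le> C * dual_norm B (\<lambda>a. \<Sum>i<m. c i * \<phi> i a)"
    unfolding BSE_functions_def by blast
  have "1 \<le> C * dual_norm B \<phi>" if "\<phi> \<in> characters B" for \<phi>
    using C[of 1 "\<lambda>_. \<phi>" "\<lambda>_. 1"] that by (simp add: \<sigma>_def)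
  with \<open>C > 0\<close> show thesis
    using that by blast
qed

section \<open>Function algebras with the uniform norm\<close>

lemma function_algebra_simps [simp]:
  "bcarrier (function_algebra A N) = A"
  "badd (function_algebra A N) = (\<lambda>f g x. f x + g x)"
  "bzero (function_algebra A N) = (\<lambda>x. 0)"
  "bscale (function_algebra A N) = (\<lambda>c f x. c * f x)"
  "bmult (function_algebra A N) = (\<lambda>f g x. f x * g x)"
  "bnorm (function_algebra A N) = N"
  "bdiff (function_algebra A N) = (\<lambda>f g x. f x - g x)"
  "(function_algebra A N)\<lparr>bnorm := N'\<rparr> = function_algebra A N'"
  by (simp_all add: function_algebra_def bdiff_def fun_eq_iff)

text \<open>The supremum is finite: \<open>f\<close> is bounded on the compact set where its modulus
  is at least \<open>1\<close>, and below \<open>1\<close> elsewhere.\<close>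

lemma norm_le_uniform_norm:
  assumes "f \<in> C0"
  shows "cmod (f x) \<le> uniform_norm f"
proof -
  let ?S = "{x. 1 \<le> cmod (f x)}"
  have "continuous_on ?S f" "compact ?S"
    using assms continuous_on_subset[of UNIV f] by (auto simp: C0_def)
  then have "bounded (f ` ?S)"
    by (intro compact_imp_bounded compact_continuous_image)
  then obtain M where M: "\<And>x. 1 \<le> cmod (f x) \<Longrightarrow> cmod (f x) \<le> M"
    by (auto simp: bounded_iff)
  have "cmod (f x) \<le> max 1 M" for x
    using M[of x] by (cases "1 \<le> cmod (f x)") auto
  then show ?thesis
    unfolding uniform_norm_def by (intro cSUP_upper bdd_aboveI2) auto
qed

lemma uniform_norm_le:
  assumes "\<And>x. cmod (f x) \<le> M"
  shows "uniform_norm f \<le> M"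
  unfolding uniform_norm_def by (rule cSUP_least) (auto simp: assms)

lemma uniform_norm_mult_le:
  assumes "f \<in> C0" "\<And>x. cmod (h x) \<le> M"
  shows "uniform_norm (\<lambda>x. f x * h x) \<le> M * uniform_norm f"
proof (rule uniform_norm_le)
  fix x
  have "0 \<le> M"
    using assms(2)[of x] norm_ge_zero order_trans by blast
  then show "cmod (f x * h x) \<le> M * uniform_norm f"
    using mult_mono[OF assms(2)[of x] norm_le_uniform_norm[OF assms(1), of x]]
    by (simp add: norm_mult mult.commute)
qed

text \<open>By naturality every character is evaluation at a point.\<close>

lemma natural_character_bound:
  assumes "natural A N" "A \<subseteq> C0" "\<phi> \<in> characters (function_algebra A N)" "f \<in> A"
  shows "cmod (\<phi> f) \<le> uniform_norm f"
proof -
  \<comment> \<open>A homeomorphism is onto the whole space, here all of \<open>characters\<close>: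
    these are extensional and hence lie in the product space.\<close>
  have "(\<lambda>x. restrict (\<lambda>f. f x) A) ` UNIV = characters (function_algebra A N)"
    using homeomorphic_imp_surjective_map[OF assms(1)[unfolded natural_def]]
    by (auto simp: gelfand_topology_def characters_def extensional_def PiE_def)
  then obtain x where "\<phi> = restrict (\<lambda>f. f x) A"
    using assms(3) by force
  then show ?thesis
    using assms norm_le_uniform_norm[of f x] by auto
qed

section \<open>Compactly supported functions and approximate identities\<close>

text \<open>Membership of the product in \<open>A\<close> is a hypothesis, so that \<open>h\<close>
  may be a local function outside \<open>A\<close>.\<close>

lemma compact_part_mult:
  fixes A :: "('a::t2_space \<Rightarrow> complex) set"
  assumes "(\<lambda>x. e x * h x) \<in> A" "e \<in> compact_part A"
  shows "(\<lambda>x. e x * h x) \<in> compact_part A"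
proof -
  have "closure {x. e x * h x \<noteq> 0} \<subseteq> closure {x. e x \<noteq> 0}"
    by (rule closure_mono) auto
  then have "closure {x. e x * h x \<noteq> 0}
      = closure {x. e x * h x \<noteq> 0} \<inter> closure {x. e x \<noteq> 0}"
    by auto
  moreover have "compact (closure {x. e x * h x \<noteq> 0} \<inter> closure {x. e x \<noteq> 0})"
    using assms by (intro closed_Int_compact) (auto simp: compact_part_def)
  ultimately show ?thesis
    using assms by (simp add: compact_part_def)
qed

text \<open>Locality gives only membership in \<open>A\<close>; compact support has to be carried
  through the induction so that locality applies again.\<close>

lemma compact_part_mult_power:
  fixes A :: "('a::t2_space \<Rightarrow> complex) set"
  assumes "\<tau> \<in> local_functions A" "f \<in> compact_part A"
  shows "(\<lambda>x. f x * \<tau> x ^ k) \<in> compact_part A"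
proof (induction k)
  case 0
  then show ?case using assms by simp
next
  case (Suc k)
  have "(\<lambda>x. (f x * \<tau> x ^ k) * \<tau> x) \<in> compact_part A"
    using assms Suc by (intro compact_part_mult[of "\<lambda>x. f x * \<tau> x ^ k"])
      (auto simp: local_functions_def)
  then show ?case
    by (simp add: mult.assoc mult.commute[of "\<tau> _"])
qed

lemma compact_part_subset_tau_algebra:
  fixes A :: "('a::t2_space \<Rightarrow> complex) set"
  assumes "\<tau> \<in> local_functions A"
  shows "compact_part A \<subseteq> tau_algebra A \<tau> n"
proof
  fix f assume "f \<in> compact_part A"
  from compact_part_mult_power[OF assms this] this show "f \<in> tau_algebra A \<tau> n"
    by (simp add: tau_algebra_def compact_part_def)
qed

text \<open>A property that holds eventually along a proper filter holds for some element.\<close>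

lemma approximate_identity_approx:
  assumes "has_bounded_approximate_identity_in B S" "a \<in> bcarrier B" "\<epsilon> > 0"
  obtains e where "e \<in> S" "e \<in> bcarrier B" "bnorm B (bdiff B (bmult B a e) a) < \<epsilon>"
proof -
  obtain F M where F: "F \<noteq> bot"
    and ev: "eventually (\<lambda>e. e \<in> bcarrier B \<and> e \<in> S \<and> bnorm B e \<le> M) F"
    and lim: "((\<lambda>e. bnorm B (bdiff B (bmult B a e) a)) \<longlongrightarrow> 0) F"
    using assms unfolding has_bounded_approximate_identity_in_def by blast
  have "eventually (\<lambda>e. (e \<in> bcarrier B \<and> e \<in> S \<and> bnorm B e \<le> M) \<and>
      bnorm B (bdiff B (bmult B a e) a) < \<epsilon>) F"
    by (intro eventually_conj ev order_tendstoD(2)[OF lim] \<open>\<epsilon> > 0\<close>)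
  from eventually_happens'[OF F this] show thesis
    using that by blast
qed

section \<open>Uniform limits and multiplication by bounded local functions\<close>

locale uniform_function_algebra =
  fixes A :: "('a::t2_space \<Rightarrow> complex) set"
  assumes banach: "banach_function_algebra A uniform_norm"
    and approx: "has_bounded_approximate_identity_in (function_algebra A uniform_norm)
      (compact_part A)"
begin

sublocale comm_banach_algebra "function_algebra A uniform_norm"
  using banach by (simp add: banach_function_algebra_def)

lemma C0: "f \<in> A \<Longrightarrow> f \<in> C0"
  using banach by (auto simp: banach_function_algebra_def)

lemma closed_add: "\<lbrakk>f \<in> A; g \<in> A\<rbrakk> \<Longrightarrow> (\<lambda>x. f x + g x) \<in> A"
  using add_closed by simp

lemma closed_scale: "f \<in> A \<Longrightarrow> (\<lambda>x. c * f x) \<in> A"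
  using scale_closed by simp

lemma closed_diff: "\<lbrakk>f \<in> A; g \<in> A\<rbrakk> \<Longrightarrow> (\<lambda>x. f x - g x) \<in> A"
  using closed_add[OF _ closed_scale[of g "-1"], of f] by simp

lemma closed_mult: "\<lbrakk>f \<in> A; g \<in> A\<rbrakk> \<Longrightarrow> (\<lambda>x. f x * g x) \<in> A"
  using mult_closed by simp

lemma compact_part_separates: "\<exists>e\<in>compact_part A. e x \<noteq> 0"
proof -
  obtain f where f: "f \<in> A" "f x \<noteq> 0"
    using banach unfolding banach_function_algebra_def strongly_separates_points_def by blast
  then obtain e where e: "e \<in> compact_part A" "e \<in> A"
    \<comment> \<open>The tolerance is chosen because \<open>e x = 0\<close> would make the error at
      \<open>x\<close> exactly \<open>cmod (f x)\<close>.\<close>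
    and less: "uniform_norm (\<lambda>x. f x * e x - f x) < cmod (f x)"
    using approximate_identity_approx[OF approx, of f "cmod (f x)"] by auto
  have "cmod (f x * e x - f x) \<le> uniform_norm (\<lambda>x. f x * e x - f x)"
    using f e by (intro norm_le_uniform_norm C0 closed_diff closed_mult)
  with less have "e x \<noteq> 0" by auto
  with e show ?thesis by blast
qed

text \<open>Completeness yields a limit in \<open>A\<close>, which must agree with \<open>g\<close>
  pointwise. The error is bounded pointwise by \<open>\<delta>\<close>, since
  \<open>uniform_norm\<close> is known to control values only on \<open>C0\<close>, and
  \<open>g\<close> is not yet known to lie there.\<close>

lemma uniformly_closed:
  assumes "\<And>m. s m \<in> A" "\<And>m x. cmod (s m x - g x) \<le> \<delta> m" "\<delta> \<longlonglongrightarrow> 0"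
  shows "g \<in> A"
proof -
  have "\<exists>M. \<forall>m\<ge>M. \<forall>k\<ge>M. uniform_norm (\<lambda>x. s m x - s k x) < e" if "e > 0" for e
  proof -
    \<comment> \<open>Two errors below \<open>e / 3\<close> leave room for the non-strict inequality
      that survives the supremum.\<close>
    have "eventually (\<lambda>m. \<delta> m < e / 3) sequentially"
      using assms(3) that by (intro order_tendstoD(2)) auto
    then obtain M where M: "\<And>m. m \<ge> M \<Longrightarrow> \<delta> m < e / 3"
      by (auto simp: eventually_sequentially)
    have "uniform_norm (\<lambda>x. s m x - s k x) < e" if "m \<ge> M" "k \<ge> M" for m k
    proof -
      have "cmod (s m x - s k x) \<le> 2 * (e / 3)" for x
        using norm_triangle_ineq4[of "s m x - g x" "s k x - g x"]
          assms(2)[of m x] assms(2)[of k x] M[OF that(1)] M[OF that(2)] by simp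
      from uniform_norm_le[of "\<lambda>x. s m x - s k x", OF this] \<open>e > 0\<close> show ?thesis by simp
    qed
    then show ?thesis by blast
  qed
  then obtain h where h: "h \<in> A" and lim: "(\<lambda>m. uniform_norm (\<lambda>x. s m x - h x)) \<longlonglongrightarrow> 0"
    using complete[of s] assms(1) by auto
  have "g x = h x" for x
  proof -
    have "(\<lambda>m. s m x - h x) \<longlonglongrightarrow> 0"
      by (rule tendsto_0_le[OF lim, where K = 1])
        (use norm_le_uniform_norm[OF C0[OF closed_diff[OF assms(1) h]]] in
          \<open>auto intro!: always_eventually intro: order_trans[OF _ abs_ge_self]\<close>)
    moreover have "(\<lambda>m. s m x - g x) \<longlonglongrightarrow> 0"
      by (rule tendsto_0_le[OF assms(3), where K = 1])
        (use assms(2) in \<open>auto intro!: always_eventually intro: order_trans[OF _ abs_ge_self]\<close>)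
    ultimately show ?thesis
      using LIMSEQ_unique[of "\<lambda>m. s m x" "h x" "g x"] by (simp add: LIM_zero_iff)
  qed
  with h show ?thesis
    by (metis ext)
qed

text \<open>Choose \<open>e m\<close> in \<open>compact_part A\<close> with \<open>f * e m\<close>
  within \<open>1 / (m + 1)\<close> of \<open>f\<close>. Locality puts
  \<open>f * e m * \<tau>\<close> in \<open>A\<close>, and boundedness of \<open>\<tau>\<close>
  makes these products converge uniformly to \<open>f * \<tau>\<close>.\<close>

lemma mult_bounded_local:
  assumes \<tau>: "\<tau> \<in> local_functions A" "\<And>x. cmod (\<tau> x) \<le> M" and f: "f \<in> A"
  shows "(\<lambda>x. f x * \<tau> x) \<in> A"
proof -
  have "\<exists>e. e \<in> compact_part A \<and> e \<in> A \<and>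
      uniform_norm (\<lambda>x. f x * e x - f x) < inverse (real (Suc m))" for m
    using approximate_identity_approx[OF approx, of f "inverse (real (Suc m))"] f
    by (auto simp del: of_nat_Suc)
  then obtain e where e: "\<And>m. e m \<in> compact_part A" "\<And>m. e m \<in> A"
    and less: "\<And>m. uniform_norm (\<lambda>x. f x * e m x - f x) < inverse (real (Suc m))"
    by metis
  show ?thesis
  proof (rule uniformly_closed)
    fix m
    have "(\<lambda>x. e m x * f x) \<in> compact_part A"
      using e f by (intro compact_part_mult closed_mult)
    with \<tau> have "(\<lambda>x. e m x * f x * \<tau> x) \<in> A"
      by (auto simp: local_functions_def)
    then show "(\<lambda>x. f x * e m x * \<tau> x) \<in> A"
      by (simp add: mult.commute)
  next
    fix m x
    have "cmod (f x * e m x - f x) \<le> inverse (real (Suc m))"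
      using norm_le_uniform_norm[OF C0[OF closed_diff[OF closed_mult[OF f e(2)[of m]] f]], of x]
        less[of m] by linarith
    then have "cmod (f x * e m x - f x) * cmod (\<tau> x) \<le> inverse (real (Suc m)) * M"
      using \<tau>(2)[of x] by (intro mult_mono) auto
    then show "cmod (f x * e m x * \<tau> x - f x * \<tau> x) \<le> inverse (real (Suc m)) * M"
      by (simp add: left_diff_distrib[symmetric] Real_Vector_Spaces.norm_mult)
  next
    show "(\<lambda>m. inverse (real (Suc m)) * M) \<longlonglongrightarrow> 0"
      using tendsto_mult_right[OF LIMSEQ_inverse_real_of_nat, of M] by simp
  qed
qed

lemma mult_bounded_local_power:
  assumes "\<tau> \<in> local_functions A" "\<And>x. cmod (\<tau> x) \<le> M" "f \<in> A"
  shows "(\<lambda>x. f x * \<tau> x ^ k) \<in> A"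
proof (induction k)
  case 0
  then show ?case using assms by simp
next
  case (Suc k)
  from mult_bounded_local[OF assms(1,2) Suc] show ?case
    by (simp add: mult.assoc mult.commute[of "\<tau> _"])
qed

section \<open>Weighted algebras\<close>

lemma uniform_norm_nonneg: "f \<in> A \<Longrightarrow> 0 \<le> uniform_norm f"
  using norm_nonneg by simp

text \<open>Used for \<open>k = n\<close> to bound evaluations and for \<open>k = 0\<close> to
  compare the two norms.\<close>

lemma uniform_norm_power_le_tau_norm:
  assumes "f \<in> tau_algebra A \<tau> n" "k \<le> n"
  shows "uniform_norm (\<lambda>x. f x * \<tau> x ^ k) \<le> tau_norm uniform_norm \<tau> n f"
  unfolding tau_norm_def
  by (rule member_le_sum) (use assms in \<open>auto simp: tau_algebra_def intro: uniform_norm_nonneg\<close>)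

lemma uniform_norm_le_tau_norm:
  assumes "f \<in> tau_algebra A \<tau> n"
  shows "uniform_norm f \<le> tau_norm uniform_norm \<tau> n f"
  using uniform_norm_power_le_tau_norm[OF assms, of 0] by simp

lemma dual_norm_evaluation_le:
  assumes "\<tau> x \<noteq> 0"
  shows "dual_norm (function_algebra (tau_algebra A \<tau> n) (tau_norm uniform_norm \<tau> n))
      (restrict (\<lambda>f. f x) (tau_algebra A \<tau> n)) \<le> 1 / cmod (\<tau> x) ^ n"
  unfolding dual_norm_def
proof (rule cSUP_least, goal_cases)
  case 1
  \<comment> \<open>The zero function shows that the unit ball is non-empty, as the supremum rule
    requires.\<close>
  have "(\<lambda>x. 0) \<in> A" "uniform_norm (\<lambda>x::'a. 0) = 0"
    using zero_closed norm_eq_zero[OF zero_closed] by simp_all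
  then have "(\<lambda>x. 0) \<in> {f \<in> tau_algebra A \<tau> n. tau_norm uniform_norm \<tau> n f \<le> 1}"
    by (simp add: tau_algebra_def tau_norm_def)
  then show ?case by auto
next
  case (2 f)
  then have f: "f \<in> tau_algebra A \<tau> n" "tau_norm uniform_norm \<tau> n f \<le> 1"
    by simp_all
  then have "(\<lambda>x. f x * \<tau> x ^ n) \<in> A"
    by (simp add: tau_algebra_def)
  from norm_le_uniform_norm[OF C0[OF this], of x] uniform_norm_power_le_tau_norm[OF f(1) order_refl] f
  have "cmod (f x) * cmod (\<tau> x) ^ n \<le> 1"
    by (simp add: Real_Vector_Spaces.norm_mult norm_power)
  then show ?case
    using f assms by (simp add: field_simps)
qed

text \<open>The point to secure is that evaluation does not vanish:
  \<open>tau_algebra A \<tau> n\<close> contains \<open>compact_part A\<close>, which has a function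
  non-zero at \<open>x\<close>.\<close>

lemma evaluation_character:
  assumes "\<tau> \<in> local_functions A"
  shows "restrict (\<lambda>f. f x) (tau_algebra A \<tau> n)
    \<in> characters (function_algebra (tau_algebra A \<tau> n) N)"
proof -
  have add: "(\<lambda>x. f x + g x) \<in> tau_algebra A \<tau> n"
    if "f \<in> tau_algebra A \<tau> n" "g \<in> tau_algebra A \<tau> n" for f g
    using that closed_add by (auto simp: tau_algebra_def distrib_right)
  have scale: "(\<lambda>x. c * f x) \<in> tau_algebra A \<tau> n" if "f \<in> tau_algebra A \<tau> n" for f c
    using that closed_scale by (auto simp: tau_algebra_def mult.assoc)
  have mult: "(\<lambda>x. f x * g x) \<in> tau_algebra A \<tau> n"
    if "f \<in> tau_algebra A \<tau> n" "g \<in> tau_algebra A \<tau> n" for f g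
    using that closed_mult by (auto simp: tau_algebra_def mult.assoc)
  have "\<exists>e\<in>tau_algebra A \<tau> n. e x \<noteq> 0"
    using compact_part_separates compact_part_subset_tau_algebra[OF assms] by blast
  then show ?thesis
    using add scale mult by (auto simp: characters_def)
qed

section \<open>The two implications\<close>

lemma BSE_imp_bounded:
  assumes "n > 0" "\<tau> \<in> local_functions A"
    and "BSE_algebra (function_algebra (tau_algebra A \<tau> n) (tau_norm uniform_norm \<tau> n))"
  shows "bounded (range \<tau>)"
proof -
  obtain C where "C > 0" and C: "\<And>\<phi>.
      \<phi> \<in> characters (function_algebra (tau_algebra A \<tau> n) (tau_norm uniform_norm \<tau> n)) \<Longrightarrow>
      1 \<le> C * dual_norm (function_algebra (tau_algebra A \<tau> n) (tau_norm uniform_norm \<tau> n)) \<phi>"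
    using BSE_algebra_single_character[OF assms(3)] by blast
  \<comment> \<open>Where the modulus exceeds \<open>1\<close>, it is at most its
    \<open>n\<close>-th power, as \<open>n > 0\<close>, and comparing the two bounds on the norm of
    the evaluation limits that power by \<open>C\<close>. Elsewhere \<open>1\<close>
    suffices.\<close>
  have "cmod (\<tau> x) \<le> max 1 C" for x
  proof (cases "cmod (\<tau> x) \<le> 1")
    case False
    then have "\<tau> x \<noteq> 0" by auto
    have "1 \<le> C * (1 / cmod (\<tau> x) ^ n)"
      using C[OF evaluation_character[OF assms(2)], of x] \<open>C > 0\<close>
        mult_left_mono[OF dual_norm_evaluation_le[of \<tau> x n, OF \<open>\<tau> x \<noteq> 0\<close>], of C] by linarith
    then have "cmod (\<tau> x) ^ n \<le> C"
      using \<open>\<tau> x \<noteq> 0\<close> by (simp add: field_simps)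
    moreover have "cmod (\<tau> x) \<le> cmod (\<tau> x) ^ n"
      using False \<open>n > 0\<close> by (simp add: self_le_power)
    ultimately show ?thesis by simp
  qed simp
  then show ?thesis
    by (auto simp: bounded_iff)
qed

text \<open>The two algebras coincide as sets of functions, so the claim is invariance of the
  BSE-property under an equivalent norm.\<close>

lemma bounded_imp_BSE:
  assumes nat: "natural A uniform_norm" and \<tau>: "\<tau> \<in> local_functions A" "bounded (range \<tau>)"
    and BSE: "BSE_algebra (function_algebra A uniform_norm)"
  shows "BSE_algebra (function_algebra (tau_algebra A \<tau> n) (tau_norm uniform_norm \<tau> n))"
proof -
  let ?N = "tau_norm uniform_norm \<tau> n"
  obtain M where "M > 0" and M: "\<And>x. cmod (\<tau> x) \<le> M"
    using \<tau>(2) by (auto simp: bounded_pos)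
  \<comment> \<open>The summand with index \<open>k\<close> is at most \<open>M ^ k\<close> times
    the uniform norm.\<close>
  define L where "L = (\<Sum>k\<le>n. M ^ k)"
  have "L > 0"
    unfolding L_def using \<open>M > 0\<close> by (intro sum_pos) auto
  have power: "(\<lambda>x. f x * \<tau> x ^ k) \<in> A" if "f \<in> A" for f k
    using mult_bounded_local_power[OF \<tau>(1) M that] .
  then have A: "tau_algebra A \<tau> n = A"
    by (auto simp: tau_algebra_def)
  have lower: "uniform_norm f \<le> ?N f" if "f \<in> A" for f
    using uniform_norm_le_tau_norm[of f \<tau> n] that A by simp
  have upper: "?N f \<le> L * uniform_norm f" if "f \<in> A" for f
    unfolding tau_norm_def L_def sum_distrib_right
    by (intro sum_mono uniform_norm_mult_le C0 that)
      (simp add: norm_power power_mono M)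
  have scale: "?N (\<lambda>x. c * f x) = cmod c * ?N f" if "f \<in> A" for c f
    unfolding tau_norm_def sum_distrib_left
    using norm_scale[of "\<lambda>x. f x * \<tau> x ^ _"] power[OF that] by (simp add: mult.assoc)
  have triangle: "?N (\<lambda>x. f x + g x) \<le> ?N f + ?N g" if "f \<in> A" "g \<in> A" for f g
    unfolding tau_norm_def sum.distrib[symmetric]
    using norm_triangle[of "\<lambda>x. f x * \<tau> x ^ _" "\<lambda>x. g x * \<tau> x ^ _"]
      power[OF that(1)] power[OF that(2)] by (intro sum_mono) (simp add: distrib_right)
  have mult: "?N (\<lambda>x. f x * g x) \<le> ?N f * ?N g" if "f \<in> A" "g \<in> A" for f g
  proof -
    \<comment> \<open>The weight \<open>\<tau> x ^ k\<close> is absorbed entirely by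
      \<open>g\<close>; the uniform norm of \<open>f\<close> is then below
      \<open>?N f\<close>.\<close>
    have "?N (\<lambda>x. f x * g x) \<le> (\<Sum>k\<le>n. uniform_norm f * uniform_norm (\<lambda>x. g x * \<tau> x ^ k))"
      unfolding tau_norm_def
      using norm_mult[of f "\<lambda>x. g x * \<tau> x ^ _"] power[OF that(2)] that(1)
      by (intro sum_mono) (simp add: mult.assoc)
    also have "\<dots> = uniform_norm f * ?N g"
      by (simp add: tau_norm_def sum_distrib_left)
    also have "\<dots> \<le> ?N f * ?N g"
      using lower[OF that(1)] order_trans[OF uniform_norm_nonneg lower, OF that(2,2)]
      by (intro mult_right_mono)
    finally show ?thesis .
  qed
  have "comm_banach_algebra ((function_algebra A uniform_norm)\<lparr>bnorm := ?N\<rparr>)"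
    by (rule comm_banach_algebra_equivalent_norm[where K = 1 and L = L])
      (use comm_banach_algebra_axioms scale triangle mult lower upper in auto)
  \<comment> \<open>Naturality enters here, to bound every character by the uniform norm.\<close>
  then have "BSE_algebra ((function_algebra A uniform_norm)\<lparr>bnorm := ?N\<rparr>)"
    by (rule BSE_algebra_equivalent_norm[OF BSE, where K = 1 and L = L])
      (use natural_character_bound[OF nat] C0 lower upper \<open>L > 0\<close> in auto)
  with A show ?thesis by simp
qed

end

theorem theorem3p3:
  fixes A :: "('a::t2_space \<Rightarrow> complex) set"
    and \<tau> :: "'a \<Rightarrow> complex"
    and n :: nat
  assumes "locally_compact_space (euclidean :: 'a topology)"
    and "\<not> compact (UNIV :: 'a set)"
    and "banach_function_algebra A uniform_norm"
    and "natural A uniform_norm"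
    and "regular A"
    and "has_bounded_approximate_identity_in (function_algebra A uniform_norm) (compact_part A)"
    and "n > 0"
    and "\<tau> \<in> local_functions A"
    and "BSE_algebra (function_algebra A uniform_norm)"
  shows "BSE_algebra (function_algebra (tau_algebra A \<tau> n) (tau_norm uniform_norm \<tau> n))
         \<longleftrightarrow> bounded (range \<tau>)"
proof -
  interpret uniform_function_algebra A
    using assms by unfold_locales
  show ?thesis
    using BSE_imp_bounded bounded_imp_BSE assms by blast
qed

end
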